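(* For every integer $d\ge1$ there are exactly $\mathrm{Cat}(d)=\frac{1}{d+1}\binom{2d}{d}$ non-redundant collections of intervals covering $[d]$.
   Context: $[d]=\{1,\dots,d\}$. An interval in $[d]$ is a nonempty set of consecutive integers $[i,i']=\{i,i+1,\dots,i'\}$ with $1\le i\le i'\le d$. A collection (set) of intervals is non-redundant if no two distinct members $I,I'$ satisfy $I\subseteq I'$. It covers $[d]$ if the union of its members is $[d]$. *)

theory Defs
  imports Complex_Main
begin

definition is_interval_in :: "nat \<Rightarrow> nat set \<Rightarrow> bool" where
  "is_interval_in d I \<longleftrightarrow> (\<exists>i i'. 1 \<le> i \<and> i \<le> i' \<and> i' \<le> d \<and> I = {i..i'})"

definition non_redundant :: "nat set set \<Rightarrow> bool" where
  "non_redundant C \<longleftrightarrow> \<not> (\<exists>I\<in>C. \<exists>I'\<in>C. I \<noteq> I' \<and> I \<subseteq> I')"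

definition nonredundant_interval_covers :: "nat \<Rightarrow> nat set set set" where
  "nonredundant_interval_covers d =
     {C. (\<forall>I\<in>C. is_interval_in d I) \<and> non_redundant C \<and> \<Union>C = {1..d}}"

end

(* Relax the problem: let B(n, m) count the non-redundant collections of intervals with left ends
   in [n] and right ends in [m] that cover [n]. If no member reaches m, the collection is counted
   by B(n, m - 1). Otherwise there is a unique member [l, m]; deleting it if l = n, and keeping it
   if l < n, gives a bijection onto the collections counted by B(n - 1, m). Thus
   B(n, m) = B(n, m - 1) + B(n - 1, m), the recursion of the ballot numbers
   (m + 1 - n) / (m + 1) * binomial(n + m, n), and the theorem is the case n = m = d. *)
theory Submission
  imports Defs
begin

section \<open>Covers with separate bounds on left and right ends\<close>

definition ballot_covers :: "nat \<Rightarrow> nat \<Rightarrow> nat set set set" where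
  "ballot_covers n m =
     {C. (\<forall>I\<in>C. \<exists>i j. 1 \<le> i \<and> i \<le> n \<and> i \<le> j \<and> j \<le> m \<and> I = {i..j})
       \<and> non_redundant C \<and> {1..n} \<subseteq> \<Union>C}"

lemma ballot_coversI:
  assumes "\<And>I. I \<in> C \<Longrightarrow> \<exists>i j. 1 \<le> i \<and> i \<le> n \<and> i \<le> j \<and> j \<le> m \<and> I = {i..j}"
    and "non_redundant C" and "{1..n} \<subseteq> \<Union>C"
  shows "C \<in> ballot_covers n m"
  using assms unfolding ballot_covers_def by blast

lemma ballot_covers_memberE:
  assumes "C \<in> ballot_covers n m" "I \<in> C"
  obtains i j where "1 \<le> i" "i \<le> n" "i \<le> j" "j \<le> m" "I = {i..j}"
  using assms unfolding ballot_covers_def by blast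

lemma ballot_covers_Union_subset:
  assumes "C \<in> ballot_covers n m"
  shows "\<Union>C \<subseteq> {1..m}"
proof (rule Union_least)
  fix I assume "I \<in> C"
  with assms show "I \<subseteq> {1..m}" by (rule ballot_covers_memberE) auto
qed

lemma ballot_covers_non_redundant: "C \<in> ballot_covers n m \<Longrightarrow> non_redundant C"
  by (simp add: ballot_covers_def)

lemma ballot_covers_Union: "C \<in> ballot_covers n m \<Longrightarrow> {1..n} \<subseteq> \<Union>C"
  by (simp add: ballot_covers_def)

lemma non_redundantD:
  "\<lbrakk>non_redundant C; I \<in> C; J \<in> C; I \<subseteq> J\<rbrakk> \<Longrightarrow> I = J"
  unfolding non_redundant_def by blast

lemma non_redundant_subset: "\<lbrakk>non_redundant C; D \<subseteq> C\<rbrakk> \<Longrightarrow> non_redundant D"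
  unfolding non_redundant_def by blast

lemma finite_ballot_covers: "finite (ballot_covers n m)"
proof (rule finite_subset)
  show "ballot_covers n m \<subseteq> Pow (Pow {1..m})"
    using ballot_covers_Union_subset by blast
qed simp

lemma ballot_covers_0: "ballot_covers 0 m = {{}}"
proof
  show "ballot_covers 0 m \<subseteq> {{}}"
    by (auto simp: ballot_covers_def)
  show "{{}} \<subseteq> ballot_covers 0 m"
    by (auto intro!: ballot_coversI simp: non_redundant_def)
qed

text \<open>Boundary value of the recursion: no member gets as far as \<open>Suc n\<close>. It
  agrees with the ballot number, whose factor \<open>m + 1 - n\<close> vanishes at
  \<open>m = n - 1\<close>.\<close>

lemma ballot_covers_Suc_self: "ballot_covers (Suc n) n = {}"
proof -
  have False if C: "C \<in> ballot_covers (Suc n) n" for C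
  proof -
    have "{1..Suc n} \<subseteq> {1..n}"
      using ballot_covers_Union[OF C] ballot_covers_Union_subset[OF C] by (rule subset_trans)
    thus False by simp
  qed
  thus ?thesis by blast
qed

section \<open>Covers that miss or attain the right bound\<close>

lemma ballot_covers_not_reaching:
  "{C \<in> ballot_covers n (Suc k). Suc k \<notin> \<Union>C} = ballot_covers n k"
proof (intro equalityI subsetI)
  fix C assume "C \<in> {C \<in> ballot_covers n (Suc k). Suc k \<notin> \<Union>C}"
  hence C: "C \<in> ballot_covers n (Suc k)" and k: "Suc k \<notin> \<Union>C" by auto
  show "C \<in> ballot_covers n k"
  proof (rule ballot_coversI)
    fix I assume I: "I \<in> C"
    from C I obtain i j where ij: "1 \<le> i" "i \<le> n" "i \<le> j" "j \<le> Suc k" "I = {i..j}"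
      by (rule ballot_covers_memberE)
    with k I have "j \<noteq> Suc k" by auto
    with ij show "\<exists>i j. 1 \<le> i \<and> i \<le> n \<and> i \<le> j \<and> j \<le> k \<and> I = {i..j}"
      by (metis le_Suc_eq)
  qed (rule ballot_covers_non_redundant[OF C] ballot_covers_Union[OF C])+
next
  fix C assume C: "C \<in> ballot_covers n k"
  have "C \<in> ballot_covers n (Suc k)"
  proof (rule ballot_coversI)
    fix I assume "I \<in> C"
    with C show "\<exists>i j. 1 \<le> i \<and> i \<le> n \<and> i \<le> j \<and> j \<le> Suc k \<and> I = {i..j}"
      by (meson ballot_covers_memberE le_SucI)
  qed (rule ballot_covers_non_redundant[OF C] ballot_covers_Union[OF C])+
  moreover have "Suc k \<notin> \<Union>C"
    using ballot_covers_Union_subset[OF C] by auto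
  ultimately show "C \<in> {C \<in> ballot_covers n (Suc k). Suc k \<notin> \<Union>C}" by simp
qed

text \<open>This is the inverse of the deletion map: a collection that already reaches
  \<open>m\<close> is kept, any other is completed by the interval that was deleted.\<close>

definition reach :: "nat \<Rightarrow> nat \<Rightarrow> nat set set \<Rightarrow> nat set set" where
  "reach n m C = (if m \<in> \<Union>C then C else insert {Suc n..m} C)"

lemma Suc_interval_notin:
  assumes "C \<in> ballot_covers n m" "Suc n \<le> m"
  shows "{Suc n..m} \<notin> C"
proof
  assume "{Suc n..m} \<in> C"
  with assms(1) obtain i j where "i \<le> n" "i \<le> j" "{Suc n..m} = {i..j}"
    by (rule ballot_covers_memberE)
  thus False using assms(2) by (simp add: Icc_eq_Icc)
qed

text \<open>Members of \<open>C\<close> start at most at \<open>n\<close>, so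
  \<open>{Suc n..m}\<close> occurs in the image exactly when it was inserted, and removing it
  recovers \<open>C\<close>.\<close>

lemma inj_on_reach:
  assumes "Suc n \<le> m"
  shows "inj_on (reach n m) (ballot_covers n m)"
proof (rule inj_onI)
  fix C D assume "C \<in> ballot_covers n m" "D \<in> ballot_covers n m" "reach n m C = reach n m D"
  moreover from this have "{Suc n..m} \<notin> C" "{Suc n..m} \<notin> D"
    using Suc_interval_notin assms by blast+
  ultimately show "C = D"
    by (simp add: reach_def insert_ident split: if_splits) blast+
qed

lemma reach_in_ballot_covers:
  assumes C: "C \<in> ballot_covers n m" and nm: "Suc n \<le> m"
  shows "reach n m C \<in> ballot_covers (Suc n) m"
proof (rule ballot_coversI)
  fix I assume "I \<in> reach n m C"
  then consider "I \<in> C" | "I = {Suc n..m}"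
    by (auto simp: reach_def split: if_splits)
  thus "\<exists>i j. 1 \<le> i \<and> i \<le> Suc n \<and> i \<le> j \<and> j \<le> m \<and> I = {i..j}"
  proof cases
    case 1
    with C show ?thesis by (meson ballot_covers_memberE le_SucI)
  next
    case 2
    with nm show ?thesis by (intro exI[of _ "Suc n"] exI[of _ m]) auto
  qed
next
  note nr = ballot_covers_non_redundant[OF C]
  show "non_redundant (reach n m C)"
  proof (cases "m \<in> \<Union>C")
    case True
    with nr show ?thesis by (simp add: reach_def)
  next
    case False
    \<comment> \<open>\<open>I\<close> starts before \<open>Suc n\<close>, which excludes the first
      inclusion, and it misses \<open>m\<close>, which excludes the second.\<close>
    have "\<not> I \<subseteq> {Suc n..m} \<and> \<not> {Suc n..m} \<subseteq> I" if I: "I \<in> C" for I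
    proof -
      from C I obtain i j where "i \<le> n" "i \<le> j" "I = {i..j}"
        by (rule ballot_covers_memberE)
      moreover have "m \<notin> I" using False I by blast
      ultimately show ?thesis using nm by auto
    qed
    with nr False show ?thesis
      by (auto simp: reach_def non_redundant_def)
  qed
next
  have "Suc n \<in> \<Union>(reach n m C)"
  proof (cases "m \<in> \<Union>C")
    case True
    then obtain I where I: "I \<in> C" "m \<in> I" by blast
    from C I(1) obtain i j where "i \<le> n" "I = {i..j}"
      by (rule ballot_covers_memberE)
    \<comment> \<open>A member that starts at most at \<open>n\<close> and contains \<open>m\<close>
      must pass over \<open>Suc n\<close>.\<close>
    with I nm have "Suc n \<in> I" by auto
    with I True show ?thesis by (auto simp: reach_def)
  qed (use nm in \<open>auto simp: reach_def\<close>)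
  moreover have "{1..n} \<subseteq> \<Union>(reach n m C)"
    using ballot_covers_Union[OF C] by (auto simp: reach_def)
  ultimately show "{1..Suc n} \<subseteq> \<Union>(reach n m C)"
    by (auto simp: atLeastAtMostSuc_conv)
qed

lemma reach_image:
  assumes nm: "Suc n \<le> m"
  shows "reach n m ` ballot_covers n m = {C \<in> ballot_covers (Suc n) m. m \<in> \<Union>C}"
proof (intro equalityI subsetI)
  fix D assume "D \<in> reach n m ` ballot_covers n m"
  then obtain C where "C \<in> ballot_covers n m" "D = reach n m C" by blast
  moreover have "m \<in> \<Union>(reach n m C)" using nm by (simp add: reach_def)
  ultimately show "D \<in> {C \<in> ballot_covers (Suc n) m. m \<in> \<Union>C}"
    using reach_in_ballot_covers nm by blast
next
  fix D assume "D \<in> {C \<in> ballot_covers (Suc n) m. m \<in> \<Union>C}"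
  hence D: "D \<in> ballot_covers (Suc n) m" and "m \<in> \<Union>D" by auto
  note nr = ballot_covers_non_redundant[OF D]
  from \<open>m \<in> \<Union>D\<close> obtain L where L: "L \<in> D" "m \<in> L" by blast
  from D L(1) obtain l j where "l \<le> Suc n" "l \<le> j" "j \<le> m" "L = {l..j}"
    by (rule ballot_covers_memberE)
  with L have Leq: "L = {l..m}" by auto
  \<comment> \<open>The preimage of \<open>D\<close>; if \<open>{Suc n..m}\<close> is not a member,
    nothing is removed.\<close>
  define C where "C = D - {{Suc n..m}}"
  have left: "\<exists>i j. 1 \<le> i \<and> i \<le> n \<and> i \<le> j \<and> j \<le> m \<and> I = {i..j}" if I: "I \<in> C" for I
  proof -
    from I have "I \<in> D" "I \<noteq> {Suc n..m}" by (auto simp: C_def)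
    from D \<open>I \<in> D\<close> obtain i j where ij: "1 \<le> i" "i \<le> Suc n" "i \<le> j" "j \<le> m" "I = {i..j}"
      by (rule ballot_covers_memberE)
    \<comment> \<open>A member starting at \<open>Suc n\<close> lies inside \<open>L\<close>, which
      starts no later and ends at the largest possible \<open>m\<close>. Non-redundancy makes it
      equal to \<open>L\<close>, hence to the removed interval.\<close>
    have "i \<noteq> Suc n"
    proof
      assume i: "i = Suc n"
      with ij Leq \<open>l \<le> Suc n\<close> have "I \<subseteq> L" by auto
      from non_redundantD[OF nr \<open>I \<in> D\<close> L(1) this] have "I = L" .
      with ij Leq i \<open>I \<noteq> {Suc n..m}\<close> show False by (simp add: Icc_eq_Icc)
    qed
    with ij show ?thesis by (metis le_Suc_eq)
  qed
  have C: "C \<in> ballot_covers n m"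
  proof (rule ballot_coversI)
    show "non_redundant C"
      using nr by (rule non_redundant_subset) (auto simp: C_def)
    show "{1..n} \<subseteq> \<Union>C"
    proof
      fix x assume x: "x \<in> {1..n}"
      with ballot_covers_Union[OF D] obtain I where "I \<in> D" "x \<in> I" by force
      \<comment> \<open>The removed interval contains no point of \<open>{1..n}\<close>, so
        \<open>I\<close> survives in \<open>C\<close>.\<close>
      with x show "x \<in> \<Union>C" by (auto simp: C_def)
    qed
  qed (rule left)
  have "reach n m C = D"
  proof (cases "{Suc n..m} \<in> D")
    case True
    \<comment> \<open>Another member reaching \<open>m\<close> would start at most at
      \<open>n\<close> and so contain \<open>{Suc n..m}\<close>, against non-redundancy of
      \<open>D\<close>.\<close>
    have "m \<notin> \<Union>C"
    proof
      assume "m \<in> \<Union>C"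
      then obtain I where I: "I \<in> C" "m \<in> I" by blast
      from left[OF I(1)] obtain i j where "i \<le> n" "I = {i..j}" by blast
      with I have "{Suc n..m} \<subseteq> I" by auto
      moreover have "I \<in> D" using I by (simp add: C_def)
      ultimately have "{Suc n..m} = I" by (intro non_redundantD[OF nr True])
      with I show False by (simp add: C_def)
    qed
    with True show ?thesis by (auto simp: reach_def C_def)
  next
    case False
    hence "C = D" by (simp add: C_def)
    with \<open>m \<in> \<Union>D\<close> show ?thesis by (simp add: reach_def)
  qed
  with C show "D \<in> reach n m ` ballot_covers n m" by blast
qed

section \<open>Ballot recursion and closed form\<close>

lemma card_ballot_covers_Suc_Suc:
  assumes "n \<le> k"
  shows "card (ballot_covers (Suc n) (Suc k)) =
    card (ballot_covers (Suc n) k) + card (ballot_covers n (Suc k))"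
proof -
  let ?B = "ballot_covers (Suc n) (Suc k)"
  have "card ?B = card ({C \<in> ?B. Suc k \<notin> \<Union>C} \<union> {C \<in> ?B. Suc k \<in> \<Union>C})"
    by (rule arg_cong[where f = card]) blast
  also have "\<dots> = card {C \<in> ?B. Suc k \<notin> \<Union>C} + card {C \<in> ?B. Suc k \<in> \<Union>C}"
    by (rule card_Un_disjoint) (use finite_ballot_covers in auto)
  also have "{C \<in> ?B. Suc k \<notin> \<Union>C} = ballot_covers (Suc n) k"
    by (rule ballot_covers_not_reaching)
  also have "{C \<in> ?B. Suc k \<in> \<Union>C} = reach n (Suc k) ` ballot_covers n (Suc k)"
    using assms by (simp add: reach_image)
  also have "card \<dots> = card (ballot_covers n (Suc k))"
    using assms by (simp add: card_image inj_on_reach)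
  finally show ?thesis .
qed

text \<open>Induction on \<open>n\<close>, and inside it on \<open>m\<close> from the boundary
  \<open>m = n - 1\<close>, where both sides are zero. Denominators are cleared, and the difference
  is taken in the reals to avoid truncation.\<close>

lemma card_ballot_covers:
  assumes "n \<le> Suc m"
  shows "(real m + 1) * real (card (ballot_covers n m)) =
    (real m + 1 - real n) * real ((n + m) choose n)"
  using assms
proof (induction n arbitrary: m)
  case 0
  show ?case by (simp add: ballot_covers_0)
next
  case (Suc n)
  hence "n \<le> m" by simp
  thus ?case
  proof (induction m rule: dec_induct)
    case base
    show ?case by (simp add: ballot_covers_Suc_self)
  next
    case (step k)
    define X Y where "X = real ((n + k + 1) choose (n + 1))" and "Y = real ((n + k + 1) choose n)"
    define a b where "a = real (card (ballot_covers (Suc n) k))"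
      and "b = real (card (ballot_covers n (Suc k)))"
    have a: "(real k + 1) * a = (real k - real n) * X"
      using step.IH by (simp add: a_def X_def)
    have b: "(real k + 2) * b = (real k + 2 - real n) * Y"
      using Suc.IH[of "Suc k"] step.hyps by (simp add: b_def Y_def algebra_simps)
    \<comment> \<open>Both sides equal \<open>(n + k + 1) * ((n + k) choose n)\<close>.\<close>
    have "Suc n * ((n + k + 1) choose Suc n) = (k + 1) * ((n + k + 1) choose n)"
      using binomial_absorb_comp[of "n + k + 1" n] binomial_absorption[of n "n + k + 1"]
      by simp
    hence "real (Suc n * ((n + k + 1) choose Suc n)) = real ((k + 1) * ((n + k + 1) choose n))"
      by (rule arg_cong)
    hence XY: "(real n + 1) * X = (real k + 1) * Y"
      by (simp add: X_def Y_def algebra_simps)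
    \<comment> \<open>The extra factor \<open>real k + 1\<close> lets equation \<open>a\<close>
      apply. After substituting \<open>a\<close> and \<open>b\<close>, the sides differ by
      \<open>(k + 1) * Y - (n + 1) * X\<close>, which is zero by \<open>XY\<close>.\<close>
    have "(real k + 1) * ((real k + 2) * (a + b)) = (real k + 1) * ((real k + 1 - real n) * (X + Y))"
      using a b XY by algebra
    hence "(real k + 2) * (a + b) = (real k + 1 - real n) * (X + Y)"
      by simp
    moreover have "real (card (ballot_covers (Suc n) (Suc k))) = a + b"
      using step.hyps by (simp add: card_ballot_covers_Suc_Suc a_def b_def)
    \<comment> \<open>Pascal's rule.\<close>
    moreover have "real ((Suc n + Suc k) choose Suc n) = X + Y"
      by (simp add: X_def Y_def)
    ultimately show ?case by (simp add: add.commute)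
  qed
qed

text \<open>With equal bounds, no member leaves \<open>{1..d}\<close>, so the inclusion required of
  a relaxed cover becomes an equality.\<close>

lemma nonredundant_interval_covers_eq: "nonredundant_interval_covers d = ballot_covers d d"
proof (intro equalityI subsetI)
  fix C assume "C \<in> nonredundant_interval_covers d"
  hence C: "\<forall>I\<in>C. is_interval_in d I" "non_redundant C" "\<Union>C = {1..d}"
    by (simp_all add: nonredundant_interval_covers_def)
  show "C \<in> ballot_covers d d"
  proof (rule ballot_coversI)
    fix I assume "I \<in> C"
    with C(1) obtain i j where "1 \<le> i" "i \<le> j" "j \<le> d" "I = {i..j}"
      unfolding is_interval_in_def by blast
    moreover from this have "i \<le> d" by simp
    ultimately show "\<exists>i j. 1 \<le> i \<and> i \<le> d \<and> i \<le> j \<and> j \<le> d \<and> I = {i..j}"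
      by blast
  qed (simp_all add: C)
next
  fix C assume C: "C \<in> ballot_covers d d"
  have "\<Union>C = {1..d}"
    using ballot_covers_Union_subset[OF C] ballot_covers_Union[OF C] by (rule equalityI)
  moreover have "is_interval_in d I" if "I \<in> C" for I
    using C that by (rule ballot_covers_memberE) (auto simp: is_interval_in_def)
  ultimately show "C \<in> nonredundant_interval_covers d"
    using ballot_covers_non_redundant[OF C] by (simp add: nonredundant_interval_covers_def)
qed

theorem proposition5p12:
  fixes d :: nat
  assumes "d \<ge> 1"
  shows "real (card (nonredundant_interval_covers d)) =
    1 / (real d + 1) * real ((2 * d) choose d)"
  \<comment> \<open>On the diagonal the factor \<open>m + 1 - n\<close> equals 1.\<close>
  using card_ballot_covers[of d d]
  by (simp add: nonredundant_interval_covers_eq field_simps flip: mult_2_right)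

end
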